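(* Let $G$ be an $n$-dimensional torus, let $\Gamma$ be a finite $d$-valent graph with vertex set $V$ equipped with a GKM action of $G$, let $f\in K_G(\Gamma)$, $f_p=e^{2\pi i\alpha_p}$, be symplectic, and let $\Delta$ be the convex hull of $\{\alpha_p : p\in V\}$ in $\mathfrak g^*$. If $\alpha$ is an extremal weight, i.e. a vertex of $\Delta$, then $\alpha$ occurs in $Q(f)$ with multiplicity $1$.
   Context: Torus notation. $\mathfrak g$ is the Lie algebra of $G$, $\mathbb Z_G=\ker(\exp:\mathfrak g\to G)$, and $\mathbb Z_G^*=\{\alpha\in\mathfrak g^*:\alpha(v)\in\mathbb Z\text{ for all }v\in\mathbb Z_G\}$ is the weight lattice. For $\alpha\in\mathbb Z_G^*$, $e^{2\pi i\alpha}:G\to S^1$ is the character $\exp(x)\mapsto e^{2\pi i\alpha(x)}$. For a compact commutative Lie group $H$, $R(H)$ is the representation ring, identified with the character ring: all finite sums $\sum m_k\chi_k$ with $m_k\in\mathbb Z$ and $\chi_k:H\to S^1$ characters. Graph and action. $E$ is the set of oriented edges of $\Gamma$ (each unoriented edge gives two oriented edges). For $e\in E$, $i(e)$ and $t(e)$ are its initial and terminal vertices and $\bar e$ is $e$ with reversed orientation. $d$-valent means each vertex $p$ has exactly $d$ oriented edges $e$ with $i(e)=p$. An action of $G$ on $\Gamma$ assigns to each $e\in E$ a one-dimensional representation $\varrho_e$ with character $\chi_e=e^{2\pi i\alpha_e}$, $\alpha_e\in\mathbb Z_G^*$, and to each $p\in V$ a $d$-dimensional representation $\tau_p$, such that,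 with $G_e=\ker\chi_e$: $\tau_p\simeq\bigoplus_{i(e)=p}\varrho_e$ for all $p$; $\varrho_{\bar e}\simeq\varrho_e^*$ (so $\alpha_{\bar e}=-\alpha_e$); and $\tau_{i(e)}|_{G_e}\simeq\tau_{t(e)}|_{G_e}$ for all $e$. The action is GKM if for any two distinct oriented edges $e_1\ne e_2$ with $i(e_1)=i(e_2)$ the weights $\alpha_{e_1},\alpha_{e_2}$ are linearly independent. It is also assumed that $\alpha_e\neq0$ for all $e$ (automatic if $d\ge2$). $K_G(\Gamma)$ is the set of functions $f:V\to R(G)$, $p\mapsto f_p$, with $r_e f_{i(e)}=r_e f_{t(e)}$ for every edge $e$, where $r_e:R(G)\to R(G_e)$ is restriction. Symplectic. Suppose $f\in K_G(\Gamma)$ has the form $f_p=e^{2\pi i\alpha_p}$ with $\alpha_p\in\mathbb Z_G^*$. Then for every oriented edge $e$ from $p$ to $q$ one has $\alpha_q-\alpha_p=m_e\alpha_e$ for some integer $m_e$; $f$ is symplectic if $m_e>0$ for all $e$. $Q(f)$ is the virtual representation of $G$ with character $\chi(f)=\sum_{p\in V}f_p\prod_{i(e)=p}(1-e^{2\pi i\alpha_e})^{-1}$, which is known to lie in $R(G)$. Writing $\chi(f)=\sum_\alpha m_\alpha e^{2\pi i\alpha}$, the multiplicity with which $\alpha$ occurs in $Q(f)$ is $m_\alpha$.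
   Formalization: The formal theorem adds that α = α_p for exactly one vertex p of Γ; without this the claim fails (e.g. the hexagon double-covering the CP² triangle gives multiplicity 2), the multiplicity being the number of p with α_p = α. *)

theory Defs
  imports
    "HOL-Analysis.Analysis"
    "Graph_Theory.Bidirected_Digraph"
    "Jordan_Normal_Form.Matrix"
begin

no_notation vec_index (infixl "$" 100)

section \<open>The torus, its weights and its characters\<close>

text \<open>
  The torus of dimension \<open>CARD('n)\<close> is taken to be the standard one, the group \<open>(S\<^sup>1)\<^sup>n\<close> inside
  \<open>complex ^ 'n\<close> under componentwise multiplication. Its Lie algebra is \<open>real ^ 'n\<close>, and the dual
  of the Lie algebra is the type \<open>(real ^ 'n) \<Rightarrow>\<^sub>L real\<close> of (bounded) linear functionals.
\<close>

type_synonym 'n lie_dual = "(real ^ 'n) \<Rightarrow>\<^sub>L real"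

definition torus :: "(complex ^ 'n::finite) set" where
  "torus = {g. \<forall>i. norm (g $ i) = 1}"

definition torus_exp :: "real ^ 'n::finite \<Rightarrow> complex ^ 'n" where
  "torus_exp x = (\<chi> i. cis (2 * pi * x $ i))"

definition exp_kernel :: "(real ^ 'n::finite) set" where
  "exp_kernel = {x. torus_exp x = 1}"

definition weight_lattice :: "('n::finite) lie_dual set" where
  "weight_lattice = {\<alpha>. \<forall>v\<in>exp_kernel. blinfun_apply \<alpha> v \<in> \<int>}"

text \<open>
  The character \<open>exp x \<mapsto> e\<^bsup>2\<pi>i\<alpha>(x)\<^esup>\<close>. It does not depend on the chosen logarithm \<open>x\<close> of \<open>g\<close> when
  \<open>\<alpha>\<close> is in the weight lattice; it is meaningful only for \<open>g\<close> in the torus.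
\<close>

definition weight_char :: "('n::finite) lie_dual \<Rightarrow> complex ^ 'n \<Rightarrow> complex" where
  "weight_char \<alpha> g = cis (2 * pi * blinfun_apply \<alpha> (SOME x. torus_exp x = g))"

section \<open>The representation ring of a closed subgroup of the torus\<close>

definition characters :: "(complex ^ 'n::finite) set \<Rightarrow> (complex ^ 'n \<Rightarrow> complex) set" where
  "characters H = {\<psi>. continuous_on H \<psi> \<and> (\<forall>g\<in>H. norm (\<psi> g) = 1) \<and>
     (\<forall>g\<in>H. \<forall>h\<in>H. \<psi> (g * h) = \<psi> g * \<psi> h)}"

text \<open>
  The elements are functions on \<open>H\<close>, extended by \<open>undefined\<close> outside \<open>H\<close>, so that equality of
  elements is equality on \<open>H\<close> and the restriction map is \<^const>\<open>restrict\<close>.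
\<close>

definition rep_ring :: "(complex ^ 'n::finite) set \<Rightarrow> (complex ^ 'n \<Rightarrow> complex) set" where
  "rep_ring H = {\<phi> \<in> extensional H. \<exists>X (m :: (complex ^ 'n \<Rightarrow> complex) \<Rightarrow> int).
     finite X \<and> X \<subseteq> characters H \<and> (\<forall>g\<in>H. \<phi> g = (\<Sum>\<psi>\<in>X. of_int (m \<psi>) * \<psi> g))}"

section \<open>Representations\<close>

definition representation ::
  "nat \<Rightarrow> (complex ^ 'n::finite) set \<Rightarrow> (complex ^ 'n \<Rightarrow> complex mat) \<Rightarrow> bool" where
  "representation d H \<rho> \<longleftrightarrow>
     (\<forall>g\<in>H. \<rho> g \<in> carrier_mat d d) \<and> \<rho> 1 = 1\<^sub>m d \<and>
     (\<forall>g\<in>H. \<forall>h\<in>H. \<rho> (g * h) = \<rho> g * \<rho> h) \<and>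
     (\<forall>i<d. \<forall>j<d. continuous_on H (\<lambda>g. \<rho> g $$ (i, j)))"

definition rep_iso :: "nat \<Rightarrow> (complex ^ 'n::finite) set \<Rightarrow>
    (complex ^ 'n \<Rightarrow> complex mat) \<Rightarrow> (complex ^ 'n \<Rightarrow> complex mat) \<Rightarrow> bool" where
  "rep_iso d H \<rho> \<sigma> \<longleftrightarrow>
     (\<exists>P\<in>carrier_mat d d. invertible_mat P \<and> (\<forall>g\<in>H. P * \<rho> g = \<sigma> g * P))"

text \<open>The direct sum of the one-dimensional representations with the listed weights.\<close>

definition weight_sum_rep ::
  "('n::finite) lie_dual list \<Rightarrow> complex ^ 'n \<Rightarrow> complex mat" where
  "weight_sum_rep ws g =
     mat (length ws) (length ws) (\<lambda>(i, j). if i = j then weight_char (ws ! i) g else 0)"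

section \<open>GKM actions on graphs\<close>

text \<open>
  Arcs are the oriented edges, \<open>tail\<close> and \<open>head\<close> are the initial and terminal vertex, and \<open>arev\<close>
  reverses the orientation (by the library's convention it fixes everything that is not an arc).
  Multiple edges are allowed.
\<close>

definition valent_graph :: "('v, 'e) pre_digraph \<Rightarrow> ('e \<Rightarrow> 'e) \<Rightarrow> nat \<Rightarrow> bool" where
  "valent_graph \<Gamma> arev d \<longleftrightarrow>
     fin_digraph \<Gamma> \<and> bidirected_digraph \<Gamma> arev \<and> (\<forall>p\<in>verts \<Gamma>. out_degree \<Gamma> p = d)"

definition edge_group :: "('e \<Rightarrow> ('n::finite) lie_dual) \<Rightarrow> 'e \<Rightarrow> (complex ^ 'n) set" where
  "edge_group w e = {g\<in>torus. weight_char (w e) g = 1}"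

text \<open>
  A one-dimensional representation of the torus is its character, so the representation attached
  to the edge \<open>e\<close> is given by its weight \<open>w e\<close>, and its dual by \<open>- w e\<close>.
\<close>

definition graph_action :: "('v, 'e) pre_digraph \<Rightarrow> ('e \<Rightarrow> 'e) \<Rightarrow> nat \<Rightarrow>
    ('e \<Rightarrow> ('n::finite) lie_dual) \<Rightarrow> ('v \<Rightarrow> complex ^ 'n \<Rightarrow> complex mat) \<Rightarrow> bool" where
  "graph_action \<Gamma> arev d w \<tau> \<longleftrightarrow>
     (\<forall>e\<in>arcs \<Gamma>. w e \<in> weight_lattice) \<and>
     (\<forall>p\<in>verts \<Gamma>. representation d torus (\<tau> p)) \<and>
     (\<forall>p\<in>verts \<Gamma>. \<exists>es. distinct es \<and> set es = out_arcs \<Gamma> p \<and>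
        rep_iso d torus (\<tau> p) (weight_sum_rep (map w es))) \<and>
     (\<forall>e\<in>arcs \<Gamma>. w (arev e) = - w e) \<and>
     (\<forall>e\<in>arcs \<Gamma>. rep_iso d (edge_group w e) (\<tau> (tail \<Gamma> e)) (\<tau> (head \<Gamma> e)))"

text \<open>
  The inequality of the two weights is needed because \<^const>\<open>independent\<close> is about sets: two equal
  nonzero weights form an independent singleton but a dependent pair.
\<close>

definition gkm_action :: "('v, 'e) pre_digraph \<Rightarrow> ('e \<Rightarrow> 'e) \<Rightarrow> nat \<Rightarrow>
    ('e \<Rightarrow> ('n::finite) lie_dual) \<Rightarrow> ('v \<Rightarrow> complex ^ 'n \<Rightarrow> complex mat) \<Rightarrow> bool" where
  "gkm_action \<Gamma> arev d w \<tau> \<longleftrightarrow>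
     graph_action \<Gamma> arev d w \<tau> \<and>
     (\<forall>e\<in>arcs \<Gamma>. w e \<noteq> 0) \<and>
     (\<forall>e1\<in>arcs \<Gamma>. \<forall>e2\<in>arcs \<Gamma>. e1 \<noteq> e2 \<and> tail \<Gamma> e1 = tail \<Gamma> e2 \<longrightarrow>
        w e1 \<noteq> w e2 \<and> independent {w e1, w e2})"

section \<open>K-theory classes and quantization\<close>

definition K_ring :: "('v, 'e) pre_digraph \<Rightarrow> ('e \<Rightarrow> ('n::finite) lie_dual) \<Rightarrow>
    ('v \<Rightarrow> complex ^ 'n \<Rightarrow> complex) set" where
  "K_ring \<Gamma> w = {f. (\<forall>p\<in>verts \<Gamma>. f p \<in> rep_ring torus) \<and>
     (\<forall>e\<in>arcs \<Gamma>. restrict (f (tail \<Gamma> e)) (edge_group w e) =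
                  restrict (f (head \<Gamma> e)) (edge_group w e))}"

text \<open>Here \<open>a\<close> gives the weights of a class with \<open>f\<^sub>p = e\<^bsup>2\<pi>i a(p)\<^esup>\<close>.\<close>

definition symplectic :: "('v, 'e) pre_digraph \<Rightarrow> ('e \<Rightarrow> ('n::finite) lie_dual) \<Rightarrow>
    ('v \<Rightarrow> 'n lie_dual) \<Rightarrow> bool" where
  "symplectic \<Gamma> w a \<longleftrightarrow>
     (\<forall>e\<in>arcs \<Gamma>. \<exists>m::int. m > 0 \<and> a (head \<Gamma> e) - a (tail \<Gamma> e) = of_int m *\<^sub>R w e)"

definition chi :: "('v, 'e) pre_digraph \<Rightarrow> ('e \<Rightarrow> ('n::finite) lie_dual) \<Rightarrow>
    ('v \<Rightarrow> complex ^ 'n \<Rightarrow> complex) \<Rightarrow> complex ^ 'n \<Rightarrow> complex" where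
  "chi \<Gamma> w f g = (\<Sum>p\<in>verts \<Gamma>. f p g * (\<Prod>e\<in>out_arcs \<Gamma> p. inverse (1 - weight_char (w e) g)))"

text \<open>A virtual representation of the torus is given by the multiplicities of its weights.\<close>

definition virtual_rep :: "(('n::finite) lie_dual \<Rightarrow> int) \<Rightarrow> bool" where
  "virtual_rep Q \<longleftrightarrow> finite {\<alpha>. Q \<alpha> \<noteq> 0} \<and> {\<alpha>. Q \<alpha> \<noteq> 0} \<subseteq> weight_lattice"

definition virtual_char :: "(('n::finite) lie_dual \<Rightarrow> int) \<Rightarrow> complex ^ 'n \<Rightarrow> complex" where
  "virtual_char Q g = (\<Sum>\<alpha> | Q \<alpha> \<noteq> 0. of_int (Q \<alpha>) * weight_char \<alpha> g)"

text \<open>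
  The formula for the character of \<open>Q(f)\<close> makes sense where no denominator vanishes. These points
  are dense in the torus, so the equation determines the virtual representation.
\<close>

definition quantization :: "('v, 'e) pre_digraph \<Rightarrow> ('e \<Rightarrow> ('n::finite) lie_dual) \<Rightarrow>
    ('v \<Rightarrow> complex ^ 'n \<Rightarrow> complex) \<Rightarrow> ('n lie_dual \<Rightarrow> int) \<Rightarrow> bool" where
  "quantization \<Gamma> w f Q \<longleftrightarrow> virtual_rep Q \<and>
     (\<forall>g\<in>torus. (\<forall>e\<in>arcs \<Gamma>. weight_char (w e) g \<noteq> 1) \<longrightarrow> virtual_char Q g = chi \<Gamma> w f g)"

end

theory Submission
  imports Defs "HOL-Complex_Analysis.Conformal_Mappings"
begin

text \<open>
  Choose \<open>\<xi>\<close> in the Lie algebra such that \<open>\<alpha>(\<xi>) < a\<^sub>p(\<xi>)\<close> for every vertex \<open>p\<close> other than the one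
  carrying \<open>\<alpha>\<close>, generic enough that no edge weight vanishes on \<open>\<xi>\<close> and that \<open>\<xi>\<close> separates the
  weights of \<open>Q(f)\<close>. Along \<open>x \<mapsto> exp(x\<xi>)\<close> both expressions for the character extend holomorphically to
  complex \<open>z\<close> in a strip \<open>0 < Re z < \<epsilon>\<close> and agree there. Multiply by \<open>e\<^bsup>-2\<pi>iz\<alpha>(\<xi>)\<^esup>\<close> and let
  \<open>Im z \<rightarrow> \<infinity>\<close>. The summand at the vertex of \<open>\<alpha>\<close> tends to 1, because being symplectic forces all
  edge weights there to be positive on \<open>\<xi>\<close>; the other summands tend to 0. A finite exponential sum
  with distinct exponents can only converge to its constant term, which is the multiplicity of \<open>\<alpha>\<close>.
\<close>

section \<open>Exponential sums in one variable\<close>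

text \<open>On the one-parameter subgroup of \<open>\<xi>\<close>, a lattice weight with value
  \<open>r\<close> at \<open>\<xi>\<close> has this function as its character. The parameter is
  complex so that the identity theorem applies.\<close>

definition expi :: "real \<Rightarrow> complex \<Rightarrow> complex" where
  "expi r z = exp (2 * of_real pi * \<i> * of_real r * z)"

lemma expi_0 [simp]: "expi 0 z = 1"
  by (simp add: expi_def)

lemma expi_add: "expi (r + s) z = expi r z * expi s z"
  by (simp add: expi_def exp_add [symmetric] algebra_simps)

lemma expi_of_real: "expi r (of_real x) = cis (2 * pi * (x * r))"
  by (simp add: expi_def cis_conv_exp algebra_simps)

lemma norm_expi: "norm (expi r z) = exp (- (2 * pi * r * Im z))"
  by (simp add: expi_def)

lemma holomorphic_on_expi [holomorphic_intros]: "expi r holomorphic_on S"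
  unfolding expi_def by (intro holomorphic_intros)

text \<open>The value 1 would make \<open>r * Re z\<close> an integer, yet it is nonzero and smaller
  than 1 in absolute value. This keeps the strip free of poles.\<close>

lemma expi_neq_1:
  assumes "r \<noteq> 0" "\<epsilon> * \<bar>r\<bar> \<le> 1" "0 < Re z" "Re z < \<epsilon>"
  shows "expi r z \<noteq> 1"
proof
  assume "expi r z = 1"
  then obtain n :: int where "2 * pi * r * Re z = of_int (2 * n) * pi"
    by (auto simp: expi_def exp_eq_1)
  then have n: "r * Re z = of_int n" by simp
  have "\<bar>r\<bar> * Re z < \<bar>r\<bar> * \<epsilon>" using assms by simp
  also have "\<dots> \<le> 1" using assms by (simp add: mult.commute)
  finally have "\<bar>r * Re z\<bar> < 1" using assms by (simp add: abs_mult)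
  moreover have "r * Re z \<noteq> 0" using assms by simp
  ultimately show False
    by (metis n of_int_0 of_int_abs of_int_less_1_iff zabs_less_one_iff)
qed

lemma tendsto_expi_pos:
  assumes "r > 0"
  shows "((\<lambda>t. expi r (Complex x t)) \<longlongrightarrow> 0) at_top"
proof -
  have "filterlim (\<lambda>t. (2 * pi * r) * t) at_top at_top"
    using assms by (intro filterlim_tendsto_pos_mult_at_top [OF tendsto_const] filterlim_ident) simp
  then have "((\<lambda>t. exp (- ((2 * pi * r) * t))) \<longlongrightarrow> 0) at_top"
    by (intro filterlim_compose [OF exp_at_bot]) (simp add: filterlim_uminus_at_bot)
  then show ?thesis
    by - (rule tendsto_norm_zero_cancel, simp add: norm_expi)
qed

lemma filterlim_expi_neg:
  assumes "r < 0"
  shows "filterlim (\<lambda>t. expi r (Complex x t)) at_infinity at_top"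
proof -
  have "filterlim (\<lambda>t. (- (2 * pi * r)) * t) at_top at_top"
    using assms
    by (intro filterlim_tendsto_pos_mult_at_top [OF tendsto_const] filterlim_ident)
      (simp add: mult_pos_neg)
  then have "filterlim (\<lambda>t. exp ((- (2 * pi * r)) * t)) at_top at_top"
    by (rule filterlim_compose [OF exp_at_top])
  then show ?thesis
    by - (rule filterlim_norm_at_top_imp_at_infinity, simp add: norm_expi)
qed

text \<open>The exponential decays for positive \<open>r\<close> and blows up for negative
  \<open>r\<close>. Both limits are finite, so these factors cannot offset a decaying
  numerator.\<close>

lemma tendsto_inverse_one_minus_expi:
  assumes "r \<noteq> 0"
  shows "((\<lambda>t. inverse (1 - expi r (Complex x t))) \<longlongrightarrow> (if r > 0 then 1 else 0)) at_top"
proof (cases "r > 0")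
  case True
  then have "((\<lambda>t. inverse (1 - expi r (Complex x t))) \<longlongrightarrow> inverse (1 - 0)) at_top"
    by (intro tendsto_intros tendsto_expi_pos) auto
  with True show ?thesis by simp
next
  case False
  with assms have "filterlim (\<lambda>t. expi r (Complex x t)) at_infinity at_top"
    by (intro filterlim_expi_neg) simp
  then have "filterlim (\<lambda>t. - 1 + expi r (Complex x t)) at_infinity at_top"
    by (intro tendsto_add_filterlim_at_infinity [OF tendsto_const])
  then have "((\<lambda>t. - inverse (- 1 + expi r (Complex x t))) \<longlongrightarrow> - 0) at_top"
    by (intro tendsto_minus filterlim_compose [OF tendsto_inverse_0])
  moreover have "- inverse (- 1 + u) = inverse (1 - u)" for u :: complex
    by (metis inverse_minus_eq minus_diff_eq uminus_add_conv_diff)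
  ultimately show ?thesis using False by simp
qed

text \<open>Distinct exponents rule out cancellation: convergence excludes growing terms with
  nonzero coefficient, and terms with positive exponent decay.\<close>

lemma exponential_sum_limit:
  assumes "finite B" and inj: "inj_on \<mu> B"
    and lim: "((\<lambda>t. \<Sum>b\<in>B. c b * expi (\<mu> b) (Complex x t)) \<longlongrightarrow> L) at_top"
  shows "L = (\<Sum>b\<in>B. if \<mu> b = 0 then c b else 0)"
proof -
  \<comment> \<open>Terms with zero coefficient may have negative exponents, so they are dropped
    first.\<close>
  define B' where "B' = {b \<in> B. c b \<noteq> 0}"
  have fin: "finite B'" using \<open>finite B\<close> by (simp add: B'_def)
  have sum_B': "(\<Sum>b\<in>B. c b * h b) = (\<Sum>b\<in>B'. c b * h b)" for h
    unfolding B'_def using \<open>finite B\<close> by (intro sum.mono_neutral_right) auto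
  have term_lim: "((\<lambda>t. c b * expi r (Complex x t)) \<longlongrightarrow> (if r = 0 then c b else 0)) at_top"
    if "r \<ge> 0" for b r
  proof (cases "r = 0")
    case False
    with that have "r > 0" by simp
    from tendsto_mult_right_zero [OF tendsto_expi_pos [OF this]] False show ?thesis by simp
  qed simp
  \<comment> \<open>Dividing the sum by its fastest growing term would otherwise give a nonzero limit, although the sum converges.\<close>
  have nonneg: "\<mu> b \<ge> 0" if b: "b \<in> B'" for b
  proof (rule ccontr)
    assume neg: "\<not> \<mu> b \<ge> 0"
    obtain m where m: "m \<in> B'" "\<And>b'. b' \<in> B' \<Longrightarrow> \<mu> m \<le> \<mu> b'"
      using ex_is_arg_min_if_finite [OF fin, of \<mu>] b unfolding is_arg_min_linorder by blast
    have "\<mu> m < 0" using m(2) [OF b] neg by simp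
    then have "((\<lambda>t. expi (- \<mu> m) (Complex x t) * (\<Sum>b\<in>B. c b * expi (\<mu> b) (Complex x t)))
      \<longlongrightarrow> 0 * L) at_top"
      by (intro tendsto_mult lim tendsto_expi_pos) simp
    moreover have "expi (- \<mu> m) z * (\<Sum>b\<in>B. c b * expi (\<mu> b) z) = (\<Sum>b\<in>B'. c b * expi (\<mu> b - \<mu> m) z)"
      for z
      unfolding sum_B' sum_distrib_left
      by (intro sum.cong refl) (simp add: diff_conv_add_uminus expi_add del: add_uminus_conv_diff)
    ultimately have "((\<lambda>t. \<Sum>b\<in>B'. c b * expi (\<mu> b - \<mu> m) (Complex x t)) \<longlongrightarrow> 0) at_top"
      by simp
    moreover have "((\<lambda>t. \<Sum>b\<in>B'. c b * expi (\<mu> b - \<mu> m) (Complex x t)) \<longlongrightarrow>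
      (\<Sum>b\<in>B'. if \<mu> b - \<mu> m = 0 then c b else 0)) at_top"
      using m by (intro tendsto_sum term_lim) simp
    ultimately have "(\<Sum>b\<in>B'. if \<mu> b - \<mu> m = 0 then c b else 0) = 0"
      by (rule tendsto_unique [OF trivial_limit_at_top_linorder, rotated])
    \<comment> \<open>By injectivity \<open>m\<close> is the only index whose normalized exponent is
      0, and \<open>c m\<close> is nonzero.\<close>
    moreover have "(\<Sum>b\<in>B'. if \<mu> b - \<mu> m = 0 then c b else 0) = (\<Sum>b\<in>B'. if b = m then c b else 0)"
      using inj m(1) by (intro sum.cong refl) (auto simp: B'_def inj_on_def)
    ultimately show False
      using m(1) fin by (simp add: B'_def)
  qed
  have "((\<lambda>t. \<Sum>b\<in>B'. c b * expi (\<mu> b) (Complex x t)) \<longlongrightarrow>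
      (\<Sum>b\<in>B'. if \<mu> b = 0 then c b else 0)) at_top"
    using nonneg by (intro tendsto_sum term_lim)
  with lim have "L = (\<Sum>b\<in>B'. if \<mu> b = 0 then c b else 0)"
    unfolding sum_B' by (rule tendsto_unique [OF trivial_limit_at_top_linorder])
  also have "\<dots> = (\<Sum>b\<in>B. if \<mu> b = 0 then c b else 0)"
    unfolding B'_def using \<open>finite B\<close> by (intro sum.mono_neutral_left) auto
  finally show ?thesis .
qed

text \<open>The difference of the two sides is holomorphic on a connected open strip and vanishes on
  a real segment that has a limit point in it.\<close>

lemma expi_identity_on_strip:
  assumes "\<epsilon> > 0"
    and W: "\<And>p e. p \<in> V \<Longrightarrow> e \<in> E p \<Longrightarrow> W e \<noteq> 0 \<and> \<epsilon> * \<bar>W e\<bar> \<le> 1"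
    and eq: "\<And>x. 0 < x \<Longrightarrow> x < \<epsilon> \<Longrightarrow> (\<Sum>b\<in>B. c b * expi (\<mu> b) (of_real x)) =
      (\<Sum>p\<in>V. expi (A p) (of_real x) * (\<Prod>e\<in>E p. inverse (1 - expi (W e) (of_real x))))"
    and z: "0 < Re z" "Re z < \<epsilon>"
  shows "(\<Sum>b\<in>B. c b * expi (\<mu> b) z) =
    (\<Sum>p\<in>V. expi (A p) z * (\<Prod>e\<in>E p. inverse (1 - expi (W e) z)))"
proof -
  define S where "S = {z. 0 < Re z} \<inter> {z. Re z < \<epsilon>}"
  define U where "U = complex_of_real ` {0<..<\<epsilon>}"
  define h where "h = (\<lambda>z. (\<Sum>b\<in>B. c b * expi (\<mu> b) z) -
    (\<Sum>p\<in>V. expi (A p) z * (\<Prod>e\<in>E p. inverse (1 - expi (W e) z))))"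
  have "open S"
    unfolding S_def by (intro open_Int open_halfspace_Re_gt open_halfspace_Re_lt)
  have "connected S"
    unfolding S_def
    by (intro convex_connected convex_Int convex_halfspace_Re_gt convex_halfspace_Re_lt)
  have nz: "1 - expi (W e) z \<noteq> 0" if "p \<in> V" "e \<in> E p" "z \<in> S" for p e z
    using expi_neq_1 [of "W e" \<epsilon> z] W that by (auto simp: S_def)
  have "h holomorphic_on S"
    unfolding h_def using nz by (intro holomorphic_intros) auto
  moreover have "U \<subseteq> S" by (auto simp: U_def S_def)
  moreover have "of_real (\<epsilon> / 2) \<in> S" using \<open>\<epsilon> > 0\<close> by (simp add: S_def)
  moreover have "of_real (\<epsilon> / 2) islimpt U"
  proof -
    have "complex_of_real x islimpt U" if "x islimpt {0<..<\<epsilon>}" for x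
      using that by (simp add: U_def islimpt_approachable dist_of_real)
    moreover have "(\<epsilon> / 2) islimpt {0<..<\<epsilon>}"
      using \<open>\<epsilon> > 0\<close> by (intro open_imp_islimpt) auto
    ultimately show ?thesis .
  qed
  moreover have "h u = 0" if u: "u \<in> U" for u
  proof -
    obtain x where "u = of_real x" "0 < x" "x < \<epsilon>" using u by (auto simp: U_def)
    then show ?thesis unfolding h_def by (simp only: eq diff_self)
  qed
  moreover have "z \<in> S" using z by (simp add: S_def)
  ultimately have "h z = 0"
    using \<open>open S\<close> \<open>connected S\<close> analytic_continuation by blast
  then show ?thesis by (simp add: h_def)
qed

text \<open>At \<open>p0\<close> the exponentials cancel and every denominator tends to 1. At any
  other vertex the combined exponential decays while the product has a finite limit.\<close>

lemma fixed_point_sum_limit: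
  assumes "finite V" "p0 \<in> V"
    and W: "\<And>p e. p \<in> V \<Longrightarrow> e \<in> E p \<Longrightarrow> W e \<noteq> 0"
    and pos: "\<And>e. e \<in> E p0 \<Longrightarrow> W e > 0"
    and A: "\<And>p. p \<in> V \<Longrightarrow> p \<noteq> p0 \<Longrightarrow> A p > A p0"
  shows "((\<lambda>t. expi (- A p0) (Complex x t) * (\<Sum>p\<in>V. expi (A p) (Complex x t) *
      (\<Prod>e\<in>E p. inverse (1 - expi (W e) (Complex x t))))) \<longlongrightarrow> 1) at_top"
proof -
  have "((\<lambda>t. expi (A p - A p0) (Complex x t) * (\<Prod>e\<in>E p. inverse (1 - expi (W e) (Complex x t))))
      \<longlongrightarrow> (if p = p0 then 1 else 0)) at_top" if "p \<in> V" for p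
  proof -
    have 1: "((\<lambda>t. expi (A p - A p0) (Complex x t)) \<longlongrightarrow> (if p = p0 then 1 else 0)) at_top"
      using A [OF that] by (auto intro!: tendsto_expi_pos)
    have 2: "((\<lambda>t. \<Prod>e\<in>E p. inverse (1 - expi (W e) (Complex x t)))
        \<longlongrightarrow> (\<Prod>e\<in>E p. if W e > 0 then 1 else 0)) at_top"
      using W [OF that] by (intro tendsto_prod tendsto_inverse_one_minus_expi)
    have "(\<Prod>e\<in>E p0. if W e > 0 then 1 else 0) = (1 :: complex)"
      using pos by simp
    with tendsto_mult [OF 1 2] show ?thesis by (cases "p = p0") simp_all
  qed
  then have "((\<lambda>t. \<Sum>p\<in>V. expi (A p - A p0) (Complex x t) *
      (\<Prod>e\<in>E p. inverse (1 - expi (W e) (Complex x t))))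
      \<longlongrightarrow> (\<Sum>p\<in>V. if p = p0 then 1 else 0)) at_top"
    by (rule tendsto_sum)
  moreover have "(\<Sum>p\<in>V. if p = p0 then 1 else 0) = (1 :: complex)"
    using assms(1,2) by simp
  moreover have "expi (A p - A p0) z = expi (- A p0) z * expi (A p) z" for p z
    by (simp flip: expi_add)
  ultimately show ?thesis
    by (simp add: sum_distrib_left mult.assoc)
qed

section \<open>Weights on the Lie algebra\<close>

lemma torus_exp_in_torus: "torus_exp x \<in> torus"
  by (simp add: torus_exp_def torus_def)

lemma torus_exp_eq_diff_in_kernel:
  assumes "torus_exp x = torus_exp y"
  shows "x - y \<in> exp_kernel"
  using assms
  by (simp add: exp_kernel_def torus_exp_def Finite_Cartesian_Product.vec_eq_iff cis_divide [symmetric] right_diff_distrib)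

text \<open>The logarithm chosen in \<open>weight_char\<close> differs from \<open>x\<close> by an
  element of \<open>exp_kernel\<close>, on which a lattice weight is integral, so the choice does
  not matter.\<close>

lemma weight_char_torus_exp:
  assumes "\<beta> \<in> weight_lattice"
  shows "weight_char \<beta> (torus_exp x) = cis (2 * pi * blinfun_apply \<beta> x)"
proof -
  define y where "y = (SOME y. torus_exp y = torus_exp x)"
  have "torus_exp y = torus_exp x"
    unfolding y_def by (rule someI) simp
  then have "blinfun_apply \<beta> (y - x) \<in> \<int>"
    using assms torus_exp_eq_diff_in_kernel by (auto simp: weight_lattice_def)
  then have "cis (2 * pi * blinfun_apply \<beta> (y - x)) = 1"
    by (auto elim!: Ints_cases)
  moreover have "2 * pi * blinfun_apply \<beta> y = 2 * pi * blinfun_apply \<beta> (y - x) + 2 * pi * blinfun_apply \<beta> x"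
    by (simp add: blinfun.diff_right algebra_simps)
  ultimately show ?thesis
    by (simp add: weight_char_def y_def [symmetric] cis_mult [symmetric])
qed

corollary weight_char_torus_exp_line:
  assumes "\<beta> \<in> weight_lattice"
  shows "weight_char \<beta> (torus_exp (x *\<^sub>R \<xi>)) = expi (blinfun_apply \<beta> \<xi>) (of_real x)"
  using weight_char_torus_exp [OF assms] by (simp add: expi_of_real blinfun.scaleR_right)

text \<open>A nonzero functional cannot vanish on a whole nonempty open set, so the functionals are
  treated one at a time, each replacing \<open>U\<close> by a nonempty open subset.\<close>

lemma exists_nonvanishing_point:
  fixes N :: "('a::real_normed_vector \<Rightarrow>\<^sub>L real) set"
  assumes "finite N" "0 \<notin> N" "open U" "U \<noteq> {}"
  shows "\<exists>\<xi>\<in>U. \<forall>\<beta>\<in>N. blinfun_apply \<beta> \<xi> \<noteq> 0"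
  using assms
proof (induction N arbitrary: U)
  case empty
  then show ?case by auto
next
  case (insert \<beta> N)
  obtain v where v: "blinfun_apply \<beta> v \<noteq> 0"
    using insert.prems(1) by (metis blinfun_eqI insertI1 zero_blinfun.rep_eq)
  define U' where "U' = U \<inter> {\<xi>. blinfun_apply \<beta> \<xi> \<noteq> 0}"
  have "open U'"
    unfolding U'_def using insert.prems by (intro open_Int open_Collect_neq continuous_intros)
  moreover have "U' \<noteq> {}"
  proof -
    obtain u where "u \<in> U" using insert.prems by auto
    show ?thesis
    proof (cases "blinfun_apply \<beta> u = 0")
      case True
      \<comment> \<open>Small positive steps along \<open>v\<close> stay in \<open>U\<close> but
        leave the kernel of \<open>\<beta>\<close>.\<close>
      have "((\<lambda>s. u + s *\<^sub>R v) \<longlongrightarrow> u + 0 *\<^sub>R v) (at_right 0)"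
        by (intro tendsto_intros)
      then have "eventually (\<lambda>s. u + s *\<^sub>R v \<in> U) (at_right 0)"
        using \<open>open U\<close> \<open>u \<in> U\<close> by (auto simp: tendsto_def)
      then have "eventually (\<lambda>s. u + s *\<^sub>R v \<in> U \<and> s > 0) (at_right 0)"
        using eventually_at_right_less by (rule eventually_conj)
      then obtain s where "u + s *\<^sub>R v \<in> U" "s > 0"
        by (metis (no_types, lifting) eventually_happens' trivial_limit_at_right_real)
      then have "u + s *\<^sub>R v \<in> U'"
        using True v by (simp add: U'_def blinfun.add_right blinfun.scaleR_right)
      then show ?thesis by auto
    qed (use \<open>u \<in> U\<close> in \<open>auto simp: U'_def\<close>)
  qed
  ultimately show ?case
    using insert.IH [of U'] insert.prems(1) by (auto simp: U'_def)
qed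

text \<open>An extreme point lies outside the hull of the other points. That hull is compact, so a
  hyperplane separates the two strictly, and its normal vector is \<open>\<xi>\<close>.\<close>

lemma extreme_point_strictly_minimal:
  fixes \<alpha> :: "('n::finite) lie_dual"
  assumes "finite S" "\<alpha> extreme_point_of (convex hull S)"
  shows "\<exists>\<xi>. \<forall>\<beta>\<in>S - {\<alpha>}. blinfun_apply \<alpha> \<xi> < blinfun_apply \<beta> \<xi>"
proof -
  \<comment> \<open>Coordinates turn functionals into vectors of \<open>real ^ 'n\<close>, so that
    the normal vector of a separating hyperplane is itself an element of the Lie algebra.\<close>
  define \<phi> :: "'n lie_dual \<Rightarrow> real ^ 'n" where "\<phi> \<beta> = (\<chi> i. blinfun_apply \<beta> (axis i 1))" for \<beta>
  have apply_eq: "blinfun_apply \<beta> \<xi> = \<xi> \<bullet> \<phi> \<beta>" for \<beta> \<xi>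
  proof -
    have "blinfun_apply \<beta> \<xi> = blinfun_apply \<beta> (\<Sum>i\<in>UNIV. \<xi> $ i *\<^sub>R axis i 1)"
      using basis_expansion [of \<xi>] by (simp add: scalar_mult_eq_scaleR)
    then show ?thesis
      by (simp add: blinfun.sum_right blinfun.scaleR_right inner_vec_def \<phi>_def)
  qed
  have "linear \<phi>"
    by (rule linearI) (simp_all add: \<phi>_def Finite_Cartesian_Product.vec_eq_iff blinfun.add_left blinfun.scaleR_left)
  have "inj \<phi>"
    by (intro injI blinfun_eqI) (simp add: apply_eq)
  \<comment> \<open>Deleting an extreme point from a convex set leaves a convex set.\<close>
  have "convex hull (S - {\<alpha>}) \<subseteq> convex hull S - {\<alpha>}"
    using assms(2) hull_subset [of S convex]
    by (intro hull_minimal) (auto simp: extreme_point_of_stillconvex)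
  then have "\<alpha> \<notin> convex hull (S - {\<alpha>})"
    by blast
  then have "\<phi> \<alpha> \<notin> convex hull (\<phi> ` (S - {\<alpha>}))"
    using \<open>inj \<phi>\<close> by (simp add: convex_hull_linear_image [OF \<open>linear \<phi>\<close>, symmetric] inj_image_mem_iff)
  moreover have "closed (convex hull (\<phi> ` (S - {\<alpha>})))"
    using \<open>finite S\<close> by (intro compact_imp_closed finite_imp_compact_convex_hull) simp
  ultimately obtain \<xi> b where "\<xi> \<bullet> \<phi> \<alpha> < b" "\<forall>x\<in>convex hull (\<phi> ` (S - {\<alpha>})). b < \<xi> \<bullet> x"
    using separating_hyperplane_closed_point [OF convex_convex_hull] by metis
  then have "blinfun_apply \<alpha> \<xi> < blinfun_apply \<beta> \<xi>" if "\<beta> \<in> S - {\<alpha>}" for \<beta>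
    using that hull_inc [of "\<phi> \<beta>" "\<phi> ` (S - {\<alpha>})" convex] by (fastforce simp: apply_eq)
  then show ?thesis by blast
qed

theorem theorem1p3:
  fixes \<Gamma> :: "('v, 'e) pre_digraph" and arev :: "'e \<Rightarrow> 'e" and d :: nat
    and w :: "'e \<Rightarrow> ('n::finite) lie_dual"
    and \<tau> :: "'v \<Rightarrow> complex ^ 'n \<Rightarrow> complex mat"
    and f :: "'v \<Rightarrow> complex ^ 'n \<Rightarrow> complex"
    and a :: "'v \<Rightarrow> 'n lie_dual"
    and Q :: "'n lie_dual \<Rightarrow> int"
    and \<alpha> :: "'n lie_dual"
  assumes graph: "valent_graph \<Gamma> arev d"
    and action: "gkm_action \<Gamma> arev d w \<tau>"
    and K_class: "f \<in> K_ring \<Gamma> w"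
    and weights: "\<And>p. p \<in> verts \<Gamma> \<Longrightarrow> a p \<in> weight_lattice"
    and form: "\<And>p. p \<in> verts \<Gamma> \<Longrightarrow> f p = restrict (weight_char (a p)) torus"
    and symplectic: "symplectic \<Gamma> w a"
    and Q: "quantization \<Gamma> w f Q"
    and extremal: "\<alpha> extreme_point_of (convex hull (a ` verts \<Gamma>))"
    and attained_once: "\<exists>!p. p \<in> verts \<Gamma> \<and> a p = \<alpha>"
  shows "Q \<alpha> = 1"
proof -
  interpret fin_digraph \<Gamma> using graph by (simp add: valent_graph_def)
  \<comment> \<open>Every vertex carrying \<open>\<alpha>\<close> contributes 1 to the limit, so the
    multiplicity counts these vertices; \<open>attained_once\<close> says that there is exactly
    one.\<close>
  obtain p0 where p0: "p0 \<in> verts \<Gamma>" "a p0 = \<alpha>"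
    and p0_unique: "\<And>p. p \<in> verts \<Gamma> \<Longrightarrow> a p = \<alpha> \<Longrightarrow> p = p0"
    using attained_once by blast

  \<comment> \<open>Choice of a generic direction\<close>
  have w_lattice: "w e \<in> weight_lattice" and w_nz: "w e \<noteq> 0" if "e \<in> arcs \<Gamma>" for e
    using action that by (auto simp: gkm_action_def graph_action_def)
  \<comment> \<open>Including \<open>\<alpha>\<close>, even if \<open>Q \<alpha>\<close> should
    vanish, lets its coefficient be read off from the limit.\<close>
  define B where "B = insert \<alpha> {\<beta>. Q \<beta> \<noteq> 0}"
  have "finite B" and Q_lattice: "\<And>\<beta>. Q \<beta> \<noteq> 0 \<Longrightarrow> \<beta> \<in> weight_lattice"
    using Q by (auto simp: B_def quantization_def virtual_rep_def)
  define U where "U = (\<Inter>\<beta>\<in>a ` verts \<Gamma> - {\<alpha>}. {\<xi>. blinfun_apply \<alpha> \<xi> < blinfun_apply \<beta> \<xi>})"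
  have "open U"
    unfolding U_def by (intro open_INT ballI open_Collect_less continuous_intros) auto
  have "U \<noteq> {}"
    using extreme_point_strictly_minimal [OF _ extremal] by (force simp: U_def)
  \<comment> \<open>The first set controls the denominators; the second makes evaluation at
    \<open>\<xi>\<close> injective on \<open>B\<close>.\<close>
  define N where "N = w ` arcs \<Gamma> \<union> ((\<lambda>(\<beta>, \<gamma>). \<beta> - \<gamma>) ` (B \<times> B) - {0})"
  have "finite N" using \<open>finite B\<close> by (simp add: N_def)
  have "0 \<notin> N" using w_nz by (force simp: N_def)
  obtain \<xi> where "\<xi> \<in> U" and generic: "\<forall>\<beta>\<in>N. blinfun_apply \<beta> \<xi> \<noteq> 0"
    using exists_nonvanishing_point [OF \<open>finite N\<close> \<open>0 \<notin> N\<close> \<open>open U\<close> \<open>U \<noteq> {}\<close>] by (rule bexE)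
  define A where "A p = blinfun_apply (a p) \<xi>" for p
  define W where "W e = blinfun_apply (w e) \<xi>" for e
  define \<mu> where "\<mu> \<beta> = blinfun_apply \<beta> \<xi>" for \<beta> :: "'n lie_dual"
  have A_less: "A p0 < A p" if "p \<in> verts \<Gamma>" "p \<noteq> p0" for p
  proof -
    have "a p \<noteq> \<alpha>" using that p0_unique by blast
    then show ?thesis using \<open>\<xi> \<in> U\<close> that p0 by (simp add: U_def A_def)
  qed
  have W_nz: "W e \<noteq> 0" if "e \<in> arcs \<Gamma>" for e
    using generic that by (simp add: W_def N_def)
  have "inj_on \<mu> B"
  proof (rule inj_onI, rule ccontr)
    fix \<beta> \<gamma> assume "\<beta> \<in> B" "\<gamma> \<in> B" "\<mu> \<beta> = \<mu> \<gamma>" "\<beta> \<noteq> \<gamma>"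
    then have "\<beta> - \<gamma> \<in> N" by (auto simp: N_def intro!: image_eqI [of _ _ "(\<beta>, \<gamma>)"])
    from bspec [OF generic this] \<open>\<mu> \<beta> = \<mu> \<gamma>\<close> show False
      by (simp add: \<mu>_def blinfun.diff_left)
  qed
  have W_pos: "W e > 0" if "e \<in> out_arcs \<Gamma> p0" for e
  proof -
    have e: "e \<in> arcs \<Gamma>" "tail \<Gamma> e = p0" using that by auto
    then obtain m :: int where m: "m > 0" "a (head \<Gamma> e) - \<alpha> = of_int m *\<^sub>R w e"
      using symplectic p0 by (auto simp: symplectic_def)
    \<comment> \<open>For a loop at \<open>p0\<close> the difference of vertex weights would be
      zero, while \<open>m\<close> and \<open>w e\<close> are not.\<close>
    then have "head \<Gamma> e \<noteq> p0" using w_nz [OF e(1)] p0 by auto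
    then have "0 < A (head \<Gamma> e) - A p0"
      using A_less [of "head \<Gamma> e"] e by simp
    also have "\<dots> = of_int m * W e"
      using arg_cong [OF m(2), of "\<lambda>\<beta>. blinfun_apply \<beta> \<xi>"] p0
      by (simp add: A_def W_def blinfun.diff_left blinfun.scaleR_left)
    finally show ?thesis using m(1) by (simp add: zero_less_mult_iff)
  qed

  \<comment> \<open>The character on a strip\<close>
  define K where "K = 1 + (\<Sum>e\<in>arcs \<Gamma>. \<bar>W e\<bar>)"
  have "K > 0" by (simp add: K_def add_pos_nonneg sum_nonneg)
  have W_le_K: "\<bar>W e\<bar> \<le> K" if "e \<in> arcs \<Gamma>" for e
    using member_le_sum [of e "arcs \<Gamma>" "\<lambda>e. \<bar>W e\<bar>"] that by (simp add: K_def)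
  \<comment> \<open>This width suits all edges at once; the summand 1 in \<open>K\<close> covers a
    graph without edges.\<close>
  define \<epsilon> where "\<epsilon> = 1 / K"
  have "\<epsilon> > 0" using \<open>K > 0\<close> by (simp add: \<epsilon>_def)
  have W_small: "\<epsilon> * \<bar>W e\<bar> \<le> 1" if "e \<in> arcs \<Gamma>" for e
    using W_le_K [OF that] \<open>K > 0\<close> by (simp add: \<epsilon>_def)
  have real_eq: "(\<Sum>\<beta>\<in>B. of_int (Q \<beta>) * expi (\<mu> \<beta>) (of_real x)) =
      (\<Sum>p\<in>verts \<Gamma>. expi (A p) (of_real x) *
        (\<Prod>e\<in>out_arcs \<Gamma> p. inverse (1 - expi (W e) (of_real x))))"
    if x: "0 < x" "x < \<epsilon>" for x
  proof -
    define g where "g = torus_exp (x *\<^sub>R \<xi>)"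
    have w_g: "weight_char (w e) g = expi (W e) (of_real x)" if "e \<in> arcs \<Gamma>" for e
      using weight_char_torus_exp_line [OF w_lattice [OF that]] by (simp add: g_def W_def)
    have "expi (W e) (of_real x) \<noteq> 1" if "e \<in> arcs \<Gamma>" for e
      using expi_neq_1 [of "W e" \<epsilon> "of_real x"] W_nz W_small that x by simp
    \<comment> \<open>No denominator vanishes at \<open>g\<close>, so the formula for the character
      of \<open>Q\<close> is available there.\<close>
    then have "virtual_char Q g = chi \<Gamma> w f g"
      using Q w_g by (simp add: quantization_def g_def torus_exp_in_torus)
    moreover have "virtual_char Q g = (\<Sum>\<beta>\<in>B. of_int (Q \<beta>) * expi (\<mu> \<beta>) (of_real x))"
    proof -
      have "virtual_char Q g = (\<Sum>\<beta> | Q \<beta> \<noteq> 0. of_int (Q \<beta>) * expi (\<mu> \<beta>) (of_real x))"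
        unfolding virtual_char_def
        by (intro sum.cong refl) (simp add: weight_char_torus_exp_line Q_lattice g_def \<mu>_def)
      also have "\<dots> = (\<Sum>\<beta>\<in>B. of_int (Q \<beta>) * expi (\<mu> \<beta>) (of_real x))"
        using \<open>finite B\<close> by (intro sum.mono_neutral_left) (auto simp: B_def)
      finally show ?thesis .
    qed
    moreover have "chi \<Gamma> w f g = (\<Sum>p\<in>verts \<Gamma>. expi (A p) (of_real x) *
        (\<Prod>e\<in>out_arcs \<Gamma> p. inverse (1 - expi (W e) (of_real x))))"
      unfolding chi_def
    proof (intro sum.cong refl arg_cong2 [of _ _ _ _ "(*)"] prod.cong)
      fix p assume "p \<in> verts \<Gamma>"
      then show "f p g = expi (A p) (of_real x)"
        using weight_char_torus_exp_line [OF weights]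
        by (simp add: form g_def torus_exp_in_torus A_def)
    qed (simp add: w_g)
    ultimately show ?thesis by simp
  qed

  \<comment> \<open>Passage to the limit\<close>
  define x0 where "x0 = \<epsilon> / 2"
  have strip_eq: "(\<Sum>p\<in>verts \<Gamma>. expi (A p) (Complex x0 t) *
        (\<Prod>e\<in>out_arcs \<Gamma> p. inverse (1 - expi (W e) (Complex x0 t)))) =
      (\<Sum>\<beta>\<in>B. of_int (Q \<beta>) * expi (\<mu> \<beta>) (Complex x0 t))" for t
  proof (rule expi_identity_on_strip [OF \<open>\<epsilon> > 0\<close> _ real_eq, symmetric])
    show "W e \<noteq> 0 \<and> \<epsilon> * \<bar>W e\<bar> \<le> 1" if "e \<in> out_arcs \<Gamma> p" for p e
      using that W_nz W_small by simp
  qed (use \<open>\<epsilon> > 0\<close> in \<open>simp_all add: x0_def\<close>)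
  \<comment> \<open>Since \<open>A p0\<close> is the value of \<open>\<alpha>\<close> at
    \<open>\<xi>\<close>, the shift moves the exponent of \<open>\<alpha>\<close> to 0 and makes its
    coefficient the constant term.\<close>
  have shift: "expi (- A p0) z * (\<Sum>\<beta>\<in>B. of_int (Q \<beta>) * expi (\<mu> \<beta>) z) =
      (\<Sum>\<beta>\<in>B. of_int (Q \<beta>) * expi (\<mu> \<beta> - A p0) z)" for z
    unfolding sum_distrib_left
    by (intro sum.cong refl) (simp add: diff_conv_add_uminus expi_add del: add_uminus_conv_diff)
  have "((\<lambda>t. expi (- A p0) (Complex x0 t) * (\<Sum>p\<in>verts \<Gamma>. expi (A p) (Complex x0 t) *
      (\<Prod>e\<in>out_arcs \<Gamma> p. inverse (1 - expi (W e) (Complex x0 t))))) \<longlongrightarrow> 1) at_top"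
    by (rule fixed_point_sum_limit) (simp_all add: p0 W_nz W_pos A_less)
  then have lim: "((\<lambda>t. \<Sum>\<beta>\<in>B. of_int (Q \<beta>) * expi (\<mu> \<beta> - A p0) (Complex x0 t)) \<longlongrightarrow> 1) at_top"
    by (simp only: strip_eq shift)
  have "inj_on (\<lambda>\<beta>. \<mu> \<beta> - A p0) B"
    using \<open>inj_on \<mu> B\<close> by (simp add: inj_on_def)
  from exponential_sum_limit [OF \<open>finite B\<close> this lim]
  have "1 = (\<Sum>\<beta>\<in>B. if \<mu> \<beta> - A p0 = 0 then complex_of_int (Q \<beta>) else 0)" .
  \<comment> \<open>Genericity of \<open>\<xi>\<close> leaves \<open>\<alpha>\<close> as the only
    element of \<open>B\<close> with shifted exponent 0.\<close>
  also have "\<dots> = (\<Sum>\<beta>\<in>B. if \<beta> = \<alpha> then complex_of_int (Q \<beta>) else 0)"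
    using \<open>inj_on \<mu> B\<close> p0 by (intro sum.cong refl) (auto simp: A_def B_def inj_on_def \<mu>_def)
  also have "\<dots> = of_int (Q \<alpha>)"
    using \<open>finite B\<close> by (simp add: B_def)
  finally show ?thesis by (metis of_int_1 of_int_eq_iff)
qed

end
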